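(* Let $G$ be a finitely generated group with large product growth, and let $A\subseteq G$ be a non-empty approximate semigroup. Then the limit $$\omega(A):=\lim_{n\to\infty}\frac1n\log|A\cap B_n|$$ exists.
   Context: $G$ is equipped with a fixed finite generating set, and $B_n$ denotes the ball of radius $n$ around the identity in the corresponding word metric. For subsets $U,V\subseteq G$, $UV=\{uv:u\in U,v\in V\}$. The group $G$ has large product growth if there exists a polynomial $P$ such that, for all $n,k$ and all finite subsets $U\subseteq B_n$ and $V\subseteq B_k$, $|UV|\ge \frac{|U|\,|V|}{P(n+k)}$. A subset $A\subseteq G$ is an approximate semigroup if there is a finite subset $X\subseteq G$ such that $A^2\subseteq AX$, where $A^2=AA$. *)

theory Defs
  imports "HOL-Analysis.Analysis" "HOL-Algebra.Algebra" "HOL-Computational_Algebra.Polynomial"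
begin

definition finite_generating_set :: "('a, 'b) monoid_scheme \<Rightarrow> 'a set \<Rightarrow> bool" where
  "finite_generating_set G S \<longleftrightarrow>
     finite S \<and> S \<subseteq> carrier G \<and> generate G S = carrier G"

text \<open>Words are over the generators and their inverses; \<open>S\<close> itself need not be symmetric.\<close>

definition word_length :: "('a, 'b) monoid_scheme \<Rightarrow> 'a set \<Rightarrow> 'a \<Rightarrow> nat" where
  "word_length G S g =
     (LEAST n. \<exists>ws. length ws = n \<and> set ws \<subseteq> S \<union> m_inv G ` S
                  \<and> g = foldr (mult G) ws (one G))"

definition word_dist :: "('a, 'b) monoid_scheme \<Rightarrow> 'a set \<Rightarrow> 'a \<Rightarrow> 'a \<Rightarrow> nat" where
  "word_dist G S g h = word_length G S (inv\<^bsub>G\<^esub> g \<otimes>\<^bsub>G\<^esub> h)"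

definition word_ball :: "('a, 'b) monoid_scheme \<Rightarrow> 'a set \<Rightarrow> nat \<Rightarrow> 'a set" where
  "word_ball G S n = {g \<in> carrier G. word_dist G S \<one>\<^bsub>G\<^esub> g \<le> n}"

text \<open>
  The positivity of \<open>P\<close> on the natural numbers is implicit in dividing by \<open>P (n + k)\<close>; without it,
  \<open>P = 0\<close> (as \<open>x / 0 = 0\<close>) or a negative \<open>P\<close> would satisfy the inequality vacuously.
\<close>

definition large_product_growth :: "('a, 'b) monoid_scheme \<Rightarrow> 'a set \<Rightarrow> bool" where
  "large_product_growth G S \<longleftrightarrow>
     (\<exists>P :: real poly. (\<forall>m :: nat. poly P (real m) > 0) \<and>
        (\<forall>(n :: nat) (k :: nat) U V.
           finite U \<longrightarrow> U \<subseteq> word_ball G S n \<longrightarrow> finite V \<longrightarrow> V \<subseteq> word_ball G S k \<longrightarrow>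
           real (card (U <#>\<^bsub>G\<^esub> V)) \<ge> real (card U) * real (card V) / poly P (real (n + k))))"

definition approximate_semigroup :: "('a, 'b) monoid_scheme \<Rightarrow> 'a set \<Rightarrow> bool" where
  "approximate_semigroup G A \<longleftrightarrow>
     A \<subseteq> carrier G \<and>
     (\<exists>F. finite F \<and> F \<subseteq> carrier G \<and> A <#>\<^bsub>G\<^esub> A \<subseteq> A <#>\<^bsub>G\<^esub> F)"

end

theory Submission
  imports Defs
begin

text \<open>
  Write \<open>a\<^sub>n\<close> for the number of elements of \<open>A\<close> in the ball of radius \<open>n\<close>. If \<open>A\<^sup>2 \<subseteq> A F\<close> with \<open>F\<close>
  finite and the inverses of the elements of \<open>F\<close> have length at most \<open>c\<close>, then multiplying the parts
  of \<open>A\<close> in the balls of radii \<open>n\<close> and \<open>k\<close> produces elements \<open>a x\<close> with \<open>x \<in> F\<close> and \<open>a \<in> A\<close> of length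
  at most \<open>n + k + c\<close>, hence at most \<open>|F| a\<^bsub>n+k+c\<^esub>\<close> products. Large product growth bounds
  the number of products from below, and together
    \<open>a\<^sub>n a\<^sub>k \<le> |F| P(n + k) a\<^bsub>n+k+c\<^esub>\<close>
  (lemma \<open>approximate_semigroup_ball_supermultiplicative\<close>).

  So \<open>log a\<^sub>n\<close> is superadditive up to a bounded shift of the index and a logarithmic error, and it
  grows at most linearly because balls grow at most exponentially. The limit then exists by a version
  of Fekete's lemma in the spirit of de Bruijn and Erdos (lemma \<open>nearly_superadditive_convergent\<close>).
  The logarithmic error is relaxed to \<open>K sqrt (n + k)\<close>. The reason that such an error is
  harmless is that \<open>J m\<close> can be assembled from \<open>J\<close> copies of \<open>m\<close> by repeated \<^emph>\<open>halving\<close>: the errors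
  made at size \<open>2\<^sup>i m\<close> then add up, per unit of length, to a geometric series dominated by
  \<open>1 / sqrt m\<close>, which vanishes as \<open>m\<close> grows.
\<close>

section \<open>Fekete's lemma with a square-root error\<close>

text \<open>
  Strict concavity of the square root, quantified for two numbers of comparable size: splitting a
  number in a balanced way gains a fixed proportion of its square root.
\<close>

lemma sqrt_add_balanced_gap:
  fixes x y :: real
  assumes "0 \<le> x" "x \<le> y" "y \<le> 2 * x"
  shows "5 * sqrt (x + y) \<le> 4 * (sqrt x + sqrt y)"
proof -
  define p q where "p = sqrt x" and "q = sqrt y"
  have pq: "0 \<le> p" "p \<le> q" and x: "x = p\<^sup>2" and y: "y = q\<^sup>2"
    using assms by (auto simp: p_def q_def)
  have "p * p \<le> p * q" using pq by (intro mult_left_mono) auto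
  moreover have "q * q \<le> 2 * (p * p)"
    using assms(3) unfolding x y power2_eq_square .
  moreover have "0 \<le> p * p" by simp
  moreover have "(4 * (p + q))\<^sup>2 = 16 * (p * p) + 32 * (p * q) + 16 * (q * q)"
    by (simp add: power2_eq_square algebra_simps)
  moreover have "(5 * sqrt (x + y))\<^sup>2 = 25 * x + 25 * y"
    using assms by (simp add: power_mult_distrib)
  moreover have "x = p * p" "y = q * q"
    unfolding x y power2_eq_square by (rule refl)+
  ultimately have "(5 * sqrt (x + y))\<^sup>2 \<le> (4 * (p + q))\<^sup>2"
    by linarith
  then have "5 * sqrt (x + y) \<le> 4 * (p + q)"
    by (rule power2_le_imp_le) (use pq in simp)
  then show ?thesis unfolding p_def q_def .
qed

text \<open>
  Halving \<open>J\<close> costs \<open>K sqrt (J m)\<close>, which is paid for by the gain of the summand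
  \<open>4 K sqrt (J m)\<close> under a balanced split; that summand is what makes the induction close.
\<close>

lemma nearly_superadditive_multiple:
  fixes h :: "nat \<Rightarrow> real"
  assumes super: "\<And>a b. N \<le> a \<Longrightarrow> N \<le> b \<Longrightarrow> h a + h b \<le> h (a + b) + K * sqrt (real (a + b))"
    and "0 \<le> K" "N \<le> m" "1 \<le> J"
  shows "real J * (h m - 4 * K * sqrt (real m)) + 4 * K * sqrt (real (J * m)) \<le> h (J * m)"
  using \<open>1 \<le> J\<close>
proof (induction J rule: less_induct)
  case (less J)
  show ?case
  proof (cases "J = 1")
    case True
    then show ?thesis by simp
  next
    case False
    define A B where "A = J div 2" and "B = J - J div 2"
    have AB: "1 \<le> A" "A \<le> B" "B \<le> 2 * A" "A + B = J" "A < J" "B < J" "1 \<le> B"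
      using False less.prems by (auto simp: A_def B_def)
    have ge: "N \<le> i * m" if "1 \<le> i" for i
      using mult_le_mono1[OF that, of m] \<open>N \<le> m\<close> by linarith
    have split: "A * m + B * m = J * m"
      by (metis AB(4) add_mult_distrib)
    have "5 * sqrt (real (A * m) + real (B * m)) \<le> 4 * (sqrt (real (A * m)) + sqrt (real (B * m)))"
    proof (rule sqrt_add_balanced_gap)
      show "real (A * m) \<le> real (B * m)"
        using AB by (metis mult_le_mono1 of_nat_mono)
      have "B * m \<le> 2 * (A * m)" using mult_le_mono1[OF AB(3), of m] by simp
      then show "real (B * m) \<le> 2 * real (A * m)"
        by (metis of_nat_le_iff of_nat_mult of_nat_numeral)
    qed simp
    then have gap: "5 * sqrt (real (J * m)) \<le> 4 * (sqrt (real (A * m)) + sqrt (real (B * m)))"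
      by (metis split of_nat_add)
    have "K * (5 * sqrt (real (J * m))) \<le> K * (4 * (sqrt (real (A * m)) + sqrt (real (B * m))))"
      by (rule mult_left_mono[OF gap \<open>0 \<le> K\<close>])
    moreover have "h (A * m) + h (B * m) \<le> h (J * m) + K * sqrt (real (J * m))"
      using super[OF ge[OF AB(1)] ge[OF AB(7)]] split by simp
    moreover have "real A * (h m - 4 * K * sqrt (real m)) + 4 * K * sqrt (real (A * m)) \<le> h (A * m)"
      using less.IH[OF AB(5) AB(1)] .
    moreover have "real B * (h m - 4 * K * sqrt (real m)) + 4 * K * sqrt (real (B * m)) \<le> h (B * m)"
      using less.IH[OF AB(6) AB(7)] .
    moreover have "real J * (h m - 4 * K * sqrt (real m))
        = real A * (h m - 4 * K * sqrt (real m)) + real B * (h m - 4 * K * sqrt (real m))"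
      unfolding AB(4)[symmetric] of_nat_add by (rule distrib_right)
    ultimately show ?thesis by (simp only: algebra_simps)
  qed
qed

text \<open>
  A general \<open>n\<close> is a multiple of \<open>m\<close> plus a bounded remainder, whose contribution is nonnegative. The
  remainder is taken in \<open>{N..<N + m}\<close> rather than \<open>{0..<m}\<close>, where nothing is known.
\<close>

lemma nearly_superadditive_eventually_ge:
  fixes h :: "nat \<Rightarrow> real"
  assumes super: "\<And>a b. N \<le> a \<Longrightarrow> N \<le> b \<Longrightarrow> h a + h b \<le> h (a + b) + K * sqrt (real (a + b))"
    and nonneg: "\<And>n. N \<le> n \<Longrightarrow> 0 \<le> h n"
    and "0 \<le> K" "N \<le> m" "1 \<le> m" "0 < \<epsilon>"
  shows "eventually (\<lambda>n. h m / real m - 4 * K / sqrt (real m) - \<epsilon> \<le> h n / real n) sequentially"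
proof -
  define q where "q = h m / real m - 4 * K / sqrt (real m)"
  have mq: "real m * q = h m - 4 * K * sqrt (real m)"
    using \<open>1 \<le> m\<close> by (simp add: q_def field_simps)
  have lower: "real n * q - real (N + m) * \<bar>q\<bar> - K * sqrt (real n) \<le> h n" if n: "N + m \<le> n" for n
  proof -
    define J r where "J = (n - N) div m" and "r = N + (n - N) mod m"
    have "J * m + (n - N) mod m = n - N"
      unfolding J_def by (rule div_mult_mod_eq)
    then have nJ: "n = J * m + r"
      using n by (simp add: r_def)
    have r: "N \<le> r" "r \<le> N + m"
      using \<open>1 \<le> m\<close> by (auto simp: r_def less_imp_le)
    have J: "1 \<le> J"
      using n \<open>1 \<le> m\<close> div_le_mono[of m "n - N" m] by (simp add: J_def)
    have "N \<le> J * m"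
      using mult_le_mono1[OF J, of m] \<open>N \<le> m\<close> by linarith
    then have "h (J * m) \<le> h n + K * sqrt (real n)"
      using super[of "J * m" r] nonneg[of r] r nJ by simp
    moreover have "real J * (real m * q) + 4 * K * sqrt (real (J * m)) \<le> h (J * m)"
      using nearly_superadditive_multiple[of N h K m J, OF super] J assms unfolding mq by blast
    moreover have "0 \<le> 4 * K * sqrt (real (J * m))"
      using \<open>0 \<le> K\<close> by simp
    moreover have "real n * q = real J * (real m * q) + real r * q"
      by (simp add: nJ algebra_simps)
    moreover have "real r * q \<le> real (N + m) * \<bar>q\<bar>"
      using r by (intro order.trans[OF mult_left_mono[of q "\<bar>q\<bar>"] mult_right_mono]) auto
    ultimately show ?thesis by linarith
  qed
  have "(\<lambda>n. q - real (N + m) * \<bar>q\<bar> * (1 / real n) - K * (1 / sqrt (real n)))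
      \<longlonglongrightarrow> q - real (N + m) * \<bar>q\<bar> * 0 - K * 0"
    by (intro tendsto_intros lim_1_over_n tendsto_divide_0[OF tendsto_const]
        filterlim_at_top_imp_at_infinity filterlim_compose[OF sqrt_at_top]
        filterlim_real_sequentially)
  then have "eventually (\<lambda>n. q - \<epsilon> <
      q - real (N + m) * \<bar>q\<bar> * (1 / real n) - K * (1 / sqrt (real n))) sequentially"
    using \<open>0 < \<epsilon>\<close> by (intro order_tendstoD(1)) auto
  then show ?thesis
    using eventually_ge_at_top[of "N + m"]
  proof eventually_elim
    case (elim n)
    have n: "0 < real n" using elim \<open>1 \<le> m\<close> by simp
    have "(real n * q - real (N + m) * \<bar>q\<bar> - K * sqrt (real n)) / real n \<le> h n / real n"
      using lower[OF elim(2)] n by (intro divide_right_mono) auto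
    moreover have "sqrt (real n) / real n = 1 / sqrt (real n)"
      using n by (simp add: divide_eq_eq eq_divide_eq)
    then have "(real n * q - real (N + m) * \<bar>q\<bar> - K * sqrt (real n)) / real n
        = q - real (N + m) * \<bar>q\<bar> * (1 / real n) - K * (1 / sqrt (real n))"
      using n unfolding diff_divide_distrib times_divide_eq_right[symmetric] by simp
    ultimately show ?case using elim(1) unfolding q_def by linarith
  qed
qed

text \<open>
  As in Fekete's lemma the limit is a supremum, here of the corrected slopes
  \<open>h m / m - 4 K / sqrt m\<close>: each of them is asymptotically a lower bound for \<open>h n / n\<close>, while
  \<open>h n / n\<close> exceeds the supremum by at most \<open>4 K / sqrt n\<close>.
\<close>

lemma nearly_superadditive_convergent:
  fixes h :: "nat \<Rightarrow> real"
  assumes super: "\<And>a b. N \<le> a \<Longrightarrow> N \<le> b \<Longrightarrow> h a + h b \<le> h (a + b) + K * sqrt (real (a + b))"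
    and nonneg: "\<And>n. N \<le> n \<Longrightarrow> 0 \<le> h n"
    and linear: "\<And>n. N \<le> n \<Longrightarrow> h n \<le> C * real n"
    and "0 \<le> K" "1 \<le> N"
  shows "convergent (\<lambda>n. h n / real n)"
proof -
  define s where "s m = h m / real m - 4 * K / sqrt (real m)" for m
  define L where "L = (SUP m\<in>{N..}. s m)"
  have "s m \<le> C" if "N \<le> m" for m
  proof -
    have "h m / real m \<le> C"
      using linear[OF that] that \<open>1 \<le> N\<close> by (simp add: divide_le_eq)
    moreover have "0 \<le> 4 * K / sqrt (real m)" using \<open>0 \<le> K\<close> by simp
    ultimately show ?thesis unfolding s_def by linarith
  qed
  then have bdd: "bdd_above (s ` {N..})"
    by (auto intro!: bdd_aboveI2)
  have upper: "h n / real n \<le> L + 4 * K * (1 / sqrt (real n))" if "N \<le> n" for n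
    using cSUP_upper[OF _ bdd, of n] that unfolding L_def s_def by simp
  have "(\<lambda>n. L + 4 * K * (1 / sqrt (real n))) \<longlonglongrightarrow> L + 4 * K * 0"
    by (intro tendsto_intros tendsto_divide_0[OF tendsto_const]
        filterlim_at_top_imp_at_infinity filterlim_compose[OF sqrt_at_top]
        filterlim_real_sequentially)
  then have upper_lim: "(\<lambda>n. L + 4 * K * (1 / sqrt (real n))) \<longlonglongrightarrow> L" by simp
  have "(\<lambda>n. h n / real n) \<longlonglongrightarrow> L"
  proof (rule order_tendstoI)
    fix l assume "l < L"
    then obtain m where m: "N \<le> m" "l < s m"
      using less_cSUP_iff[OF _ bdd] unfolding L_def by auto
    have "eventually (\<lambda>n. s m - (s m - l) / 2 \<le> h n / real n) sequentially"
      unfolding s_def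
      by (rule nearly_superadditive_eventually_ge[OF super nonneg])
        (use m \<open>0 \<le> K\<close> \<open>1 \<le> N\<close> in \<open>auto simp: s_def\<close>)
    then show "eventually (\<lambda>n. l < h n / real n) sequentially"
      by eventually_elim (use m in argo)
  next
    fix u assume "L < u"
    then have "eventually (\<lambda>n. L + 4 * K * (1 / sqrt (real n)) < u) sequentially"
      by (rule order_tendstoD(2)[OF upper_lim])
    then show "eventually (\<lambda>n. h n / real n < u) sequentially"
      using eventually_ge_at_top[of N]
      by eventually_elim (use upper in fastforce)
  qed
  then show ?thesis by (rule convergentI)
qed

text \<open>
  A bounded shift \<open>c\<close> of the index is absorbed by passing to \<open>h n = f (n - c)\<close>, which has the same
  asymptotic slope as \<open>f\<close>.
\<close>

lemma nearly_superadditive_shift_convergent: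
  fixes f :: "nat \<Rightarrow> real"
  assumes super: "\<And>a b. N \<le> a \<Longrightarrow> N \<le> b \<Longrightarrow>
      f a + f b \<le> f (a + b + c) + K * sqrt (real (a + b))"
    and nonneg: "\<And>n. N \<le> n \<Longrightarrow> 0 \<le> f n"
    and linear: "\<And>n. N \<le> n \<Longrightarrow> f n \<le> C * real n"
    and "0 \<le> K" "1 \<le> N"
  shows "convergent (\<lambda>n. f n / real n)"
proof -
  define h where "h n = f (n - c)" for n
  have "0 \<le> C"
    using nonneg[of N] linear[of N] \<open>1 \<le> N\<close> zero_le_mult_iff[of C "real N"] by auto
  have "convergent (\<lambda>n. h n / real n)"
  proof (rule nearly_superadditive_convergent[where N = "N + c" and K = K and C = C])
    fix a b assume ab: "N + c \<le> a" "N + c \<le> b"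
    have "f (a - c) + f (b - c) \<le> f (a - c + (b - c) + c) + K * sqrt (real (a - c + (b - c)))"
      using ab by (intro super) auto
    moreover have "a - c + (b - c) + c = a + b - c" using ab by simp
    moreover have "K * sqrt (real (a - c + (b - c))) \<le> K * sqrt (real (a + b))"
      using \<open>0 \<le> K\<close> by (intro mult_left_mono real_sqrt_le_mono) auto
    ultimately show "h a + h b \<le> h (a + b) + K * sqrt (real (a + b))"
      unfolding h_def by simp
  next
    fix n assume n: "N + c \<le> n"
    show "0 \<le> h n" unfolding h_def using n by (intro nonneg) auto
    have "f (n - c) \<le> C * real (n - c)" using n by (intro linear) auto
    also have "\<dots> \<le> C * real n" using \<open>0 \<le> C\<close> by (intro mult_left_mono) auto
    finally show "h n \<le> C * real n" unfolding h_def .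
  qed (use assms in auto)
  then obtain L where "(\<lambda>n. h n / real n) \<longlonglongrightarrow> L"
    by (auto simp: convergent_def)
  then have "(\<lambda>n. h (n + c) / real (n + c)) \<longlonglongrightarrow> L"
    by (rule LIMSEQ_ignore_initial_segment)
  moreover have "(\<lambda>n. 1 + real c * (1 / real n)) \<longlonglongrightarrow> 1 + real c * 0"
    by (intro tendsto_intros lim_1_over_n)
  ultimately have "(\<lambda>n. h (n + c) / real (n + c) * (1 + real c * (1 / real n)))
      \<longlonglongrightarrow> L * (1 + real c * 0)"
    by (rule tendsto_mult)
  then have "(\<lambda>n. f n / real n) \<longlonglongrightarrow> L * (1 + real c * 0)"
  proof (rule Lim_transform_eventually)
    show "eventually (\<lambda>n. h (n + c) / real (n + c) * (1 + real c * (1 / real n)) = f n / real n)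
        sequentially"
      using eventually_gt_at_top[of 0]
    proof eventually_elim
      case (elim n)
      then have "1 + real c * (1 / real n) = real (n + c) / real n"
        by (simp add: field_simps)
      then show ?case using elim by (simp add: h_def)
    qed
  qed
  then show ?thesis by (rule convergentI)
qed

section \<open>Logarithms of polynomials\<close>

lemma poly_le_power_bound:
  fixes p :: "real poly"
  shows "\<exists>B d. 1 \<le> B \<and> (\<forall>n::nat. \<bar>poly p (real n)\<bar> \<le> B * (real n + 1) ^ d)"
proof (induction p)
  case 0
  show ?case by (intro exI[of _ 1] exI[of _ 0]) simp
next
  case (pCons a p)
  then obtain B d where B: "1 \<le> B" "\<And>n::nat. \<bar>poly p (real n)\<bar> \<le> B * (real n + 1) ^ d"
    by blast
  have "\<bar>poly (pCons a p) (real n)\<bar> \<le> (\<bar>a\<bar> + B) * (real n + 1) ^ Suc d" for n :: nat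
  proof -
    have "\<bar>poly (pCons a p) (real n)\<bar> \<le> \<bar>a\<bar> + real n * \<bar>poly p (real n)\<bar>"
      using abs_triangle_ineq[of a "real n * poly p (real n)"] by (simp add: abs_mult)
    also have "real n * \<bar>poly p (real n)\<bar> \<le> (real n + 1) * (B * (real n + 1) ^ d)"
      using B by (intro mult_mono) auto
    also have "\<bar>a\<bar> \<le> \<bar>a\<bar> * (real n + 1) ^ Suc d"
      using mult_left_mono[OF one_le_power[of "real n + 1" "Suc d"] abs_ge_zero[of a]] by simp
    finally show ?thesis by (simp add: algebra_simps)
  qed
  then show ?case
    using B(1) by (intro exI[of _ "\<bar>a\<bar> + B"] exI[of _ "Suc d"]) auto
qed

lemma ln_poly_le_sqrt:
  fixes p :: "real poly"
  assumes pos: "\<And>n::nat. 0 < poly p (real n)"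
  shows "\<exists>K\<ge>0. \<forall>n\<ge>1::nat. ln (poly p (real n)) \<le> K * sqrt (real n)"
proof -
  obtain B d where B: "1 \<le> B" "\<And>n::nat. \<bar>poly p (real n)\<bar> \<le> B * (real n + 1) ^ d"
    using poly_le_power_bound[of p] by blast
  define K where "K = ln B + 4 * real d"
  have "ln (poly p (real n)) \<le> K * sqrt (real n)" if "1 \<le> n" for n :: nat
  proof -
    have "ln (poly p (real n)) \<le> ln (B * (real n + 1) ^ d)"
      using B pos[of n] by (intro ln_mono) (auto intro: order.trans[OF abs_ge_self])
    also have "\<dots> = ln B + real d * ln (real n + 1)"
      using B(1) by (subst ln_mult) (auto simp: ln_realpow)
    finally have "ln (poly p (real n)) \<le> ln B + real d * ln (real n + 1)" .
    moreover have "ln (real n + 1) \<le> 4 * sqrt (real n)"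
    proof -
      have "ln (real n + 1) = 2 * ln (sqrt (real n + 1))"
        by (simp add: ln_sqrt)
      also have "\<dots> \<le> 2 * sqrt (real n + 1)"
        using ln_bound[of "sqrt (real n + 1)"] by simp
      also have "sqrt (real n + 1) \<le> sqrt (4 * real n)"
        using that by (intro real_sqrt_le_mono) auto
      finally show ?thesis by (simp add: real_sqrt_mult)
    qed
    then have "real d * ln (real n + 1) \<le> real d * (4 * sqrt (real n))"
      by (rule mult_left_mono) simp
    moreover have "ln B \<le> ln B * sqrt (real n)"
      using B(1) that mult_left_mono[of 1 "sqrt (real n)" "ln B"] by simp
    ultimately show ?thesis by (simp add: K_def algebra_simps)
  qed
  moreover have "0 \<le> K" using B(1) by (simp add: K_def)
  ultimately show ?thesis by blast
qed

section \<open>Balls in the word metric\<close>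

lemma (in group) foldr_mult_closed:
  "set ws \<subseteq> carrier G \<Longrightarrow> foldr (\<otimes>) ws \<one> \<in> carrier G"
  by (induction ws) auto

lemma (in group) foldr_mult_append:
  "set us \<subseteq> carrier G \<Longrightarrow> set vs \<subseteq> carrier G \<Longrightarrow>
    foldr (\<otimes>) us (foldr (\<otimes>) vs \<one>) = foldr (\<otimes>) us \<one> \<otimes> foldr (\<otimes>) vs \<one>"
  by (induction us) (auto simp: foldr_mult_closed m_assoc)

text \<open>
  Word length is a least number, meaningful only for elements that are represented by some word; this
  is where generation enters.
\<close>

lemma (in group) generated_has_word:
  assumes "S \<subseteq> carrier G" "g \<in> generate G S"
  shows "\<exists>ws. set ws \<subseteq> S \<union> m_inv G ` S \<and> g = foldr (\<otimes>) ws \<one>"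
  using assms(2)
proof (induction g rule: generate.induct)
  case one
  show ?case by (intro exI[of _ "[]"]) simp
next
  case (incl h)
  then show ?case using assms(1) by (intro exI[of _ "[h]"]) auto
next
  case (inv h)
  then show ?case using assms(1) by (intro exI[of _ "[inv h]"]) auto
next
  case (eng g h)
  then obtain us vs where
    "set us \<subseteq> S \<union> m_inv G ` S" "g = foldr (\<otimes>) us \<one>"
    "set vs \<subseteq> S \<union> m_inv G ` S" "h = foldr (\<otimes>) vs \<one>" by blast
  moreover have "S \<union> m_inv G ` S \<subseteq> carrier G" using assms(1) by auto
  ultimately show ?case
    by (intro exI[of _ "us @ vs"]) (auto intro!: foldr_mult_append[symmetric])
qed

lemma (in group) word_ball_eq_words:
  assumes "finite_generating_set G S"
  shows "word_ball G S n =
    (\<lambda>ws. foldr (\<otimes>) ws \<one>) ` {ws. set ws \<subseteq> S \<union> m_inv G ` S \<and> length ws \<le> n}"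
    (is "_ = ?R")
proof
  have S: "S \<subseteq> carrier G" "generate G S = carrier G"
    using assms by (auto simp: finite_generating_set_def)
  then have T: "S \<union> m_inv G ` S \<subseteq> carrier G" by auto
  have dist: "word_dist G S \<one> g = word_length G S g" if "g \<in> carrier G" for g
    using that by (simp add: word_dist_def)
  show "word_ball G S n \<subseteq> ?R"
  proof
    fix g assume "g \<in> word_ball G S n"
    then have g: "g \<in> carrier G" "word_length G S g \<le> n"
      by (auto simp: word_ball_def dist)
    let ?Q = "\<lambda>k. \<exists>ws. length ws = k \<and> set ws \<subseteq> S \<union> m_inv G ` S \<and> g = foldr (\<otimes>) ws \<one>"
    have "\<exists>k. ?Q k" using generated_has_word[OF S(1), of g] S(2) g(1) by blast
    then have "?Q (LEAST k. ?Q k)" by (rule LeastI_ex)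
    then have "?Q (word_length G S g)" unfolding word_length_def .
    then show "g \<in> ?R" using g(2) by auto
  qed
  show "?R \<subseteq> word_ball G S n"
  proof
    fix g assume "g \<in> ?R"
    then obtain ws where ws: "set ws \<subseteq> S \<union> m_inv G ` S" "length ws \<le> n" "g = foldr (\<otimes>) ws \<one>"
      by auto
    have g: "g \<in> carrier G"
      unfolding ws(3) using ws(1) T by (intro foldr_mult_closed) auto
    have "word_length G S g \<le> length ws"
      unfolding word_length_def using ws by (intro Least_le) auto
    then show "g \<in> word_ball G S n"
      using ws(2) g by (simp add: word_ball_def dist)
  qed
qed

lemma word_ball_mono: "m \<le> n \<Longrightarrow> word_ball G S m \<subseteq> word_ball G S n"
  by (auto simp: word_ball_def)

lemma (in group) word_ball_mult:
  assumes fg: "finite_generating_set G S"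
    and "g \<in> word_ball G S m" "h \<in> word_ball G S n"
  shows "g \<otimes> h \<in> word_ball G S (m + n)"
proof -
  have T: "S \<union> m_inv G ` S \<subseteq> carrier G"
    using fg by (auto simp: finite_generating_set_def)
  obtain us vs where
    "set us \<subseteq> S \<union> m_inv G ` S" "length us \<le> m" "g = foldr (\<otimes>) us \<one>"
    "set vs \<subseteq> S \<union> m_inv G ` S" "length vs \<le> n" "h = foldr (\<otimes>) vs \<one>"
    using assms(2,3) unfolding word_ball_eq_words[OF fg] by auto
  with T show ?thesis unfolding word_ball_eq_words[OF fg]
    by (intro image_eqI[of _ _ "us @ vs"]) (auto intro!: foldr_mult_append[symmetric])
qed

lemma finite_subset_word_ball:
  assumes "finite F" "F \<subseteq> carrier G"
  shows "\<exists>c. F \<subseteq> word_ball G S c"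
proof (intro exI subsetI)
  fix g assume "g \<in> F"
  then show "g \<in> word_ball G S (Max (word_dist G S \<one>\<^bsub>G\<^esub> ` F))"
    using assms by (auto simp: word_ball_def)
qed

lemma sum_power_le_power_Suc_base: "(\<Sum>i\<le>n. t ^ i) \<le> Suc t ^ n"
proof (induction n)
  case (Suc n)
  have "t * t ^ n \<le> t * Suc t ^ n"
    by (intro mult_left_mono power_mono) auto
  then have "sum ((^) t) {..n} + t * t ^ n \<le> Suc t ^ n + t * Suc t ^ n"
    using Suc by (rule add_mono[rotated])
  then show ?case by simp
qed simp

lemma (in group) word_ball_finite_card_le:
  assumes fg: "finite_generating_set G S"
  shows "finite (word_ball G S n)"
    and "card (word_ball G S n) \<le> Suc (card (S \<union> m_inv G ` S)) ^ n"
proof -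
  have fin: "finite (S \<union> m_inv G ` S)"
    using fg by (auto simp: finite_generating_set_def)
  note words = finite_lists_length_le[OF fin, of n] card_lists_length_le[OF fin, of n]
  show "finite (word_ball G S n)"
    unfolding word_ball_eq_words[OF fg] using words(1) by simp
  have "card (word_ball G S n) \<le> (\<Sum>i\<le>n. card (S \<union> m_inv G ` S) ^ i)"
    unfolding word_ball_eq_words[OF fg] words(2)[symmetric] by (rule card_image_le[OF words(1)])
  also have "\<dots> \<le> Suc (card (S \<union> m_inv G ` S)) ^ n"
    by (rule sum_power_le_power_Suc_base)
  finally show "card (word_ball G S n) \<le> Suc (card (S \<union> m_inv G ` S)) ^ n" .
qed

section \<open>Growth of approximate semigroups\<close>

text \<open>
  If \<open>u v = a x\<close> with \<open>x \<in> F\<close>, then \<open>a = u v x\<^sup>-\<^sup>1\<close> lies in a ball only slightly larger than the one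
  containing \<open>u v\<close>. Hence the products \<open>u v\<close> lie in the translates by \<open>F\<close> of the part of \<open>A\<close> in that
  ball.
\<close>

lemma (in group) approximate_semigroup_card_product_le:
  assumes fg: "finite_generating_set G S"
    and A: "A \<subseteq> carrier G" and F: "finite F" "F \<subseteq> carrier G"
    and AF: "A <#> A \<subseteq> A <#> F"
    and c: "m_inv G ` F \<subseteq> word_ball G S c"
  shows "card ((A \<inter> word_ball G S n) <#> (A \<inter> word_ball G S k))
    \<le> card (A \<inter> word_ball G S (n + k + c)) * card F"
proof -
  let ?W = "A \<inter> word_ball G S (n + k + c)"
  have fin: "finite (?W \<times> F)"
    using word_ball_finite_card_le(1)[OF fg] F(1) by simp
  have "(A \<inter> word_ball G S n) <#> (A \<inter> word_ball G S k) \<subseteq> (\<lambda>(a, x). a \<otimes> x) ` (?W \<times> F)"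
  proof
    fix g assume "g \<in> (A \<inter> word_ball G S n) <#> (A \<inter> word_ball G S k)"
    then obtain u v where uv: "u \<in> A" "u \<in> word_ball G S n" "v \<in> A" "v \<in> word_ball G S k"
        "g = u \<otimes> v"
      by (auto simp: set_mult_def)
    then have "g \<in> A <#> A" by (auto simp: set_mult_def)
    then have "g \<in> A <#> F" using AF by blast
    then obtain a x where ax: "a \<in> A" "x \<in> F" "g = a \<otimes> x" by (auto simp: set_mult_def)
    then have "a \<in> carrier G" "x \<in> carrier G" using A F by auto
    then have "a = g \<otimes> inv x" by (simp add: ax(3) m_assoc)
    moreover have "g \<in> word_ball G S (n + k)"
      unfolding uv(5) by (rule word_ball_mult[OF fg uv(2) uv(4)])
    moreover have "inv x \<in> word_ball G S c" using c ax by auto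
    ultimately have "a \<in> word_ball G S (n + k + c)"
      using word_ball_mult[OF fg] by simp
    then show "g \<in> (\<lambda>(a, x). a \<otimes> x) ` (?W \<times> F)" using ax by auto
  qed
  then have "card ((A \<inter> word_ball G S n) <#> (A \<inter> word_ball G S k)) \<le> card (?W \<times> F)"
    by (rule surj_card_le[OF fin])
  then show ?thesis by (simp add: card_cartesian_product)
qed

text \<open>The polynomial \<open>Q\<close> absorbs the number of translates.\<close>

lemma (in group) approximate_semigroup_ball_supermultiplicative:
  assumes fg: "finite_generating_set G S"
    and growth: "large_product_growth G S"
    and "A \<noteq> {}" and A: "approximate_semigroup G A"
  obtains Q :: "real poly" and c where
    "\<And>m::nat. 0 < poly Q (real m)"
    "\<And>n k. real (card (A \<inter> word_ball G S n)) * real (card (A \<inter> word_ball G S k))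
        \<le> poly Q (real (n + k)) * real (card (A \<inter> word_ball G S (n + k + c)))"
proof -
  obtain P :: "real poly" where Ppos: "\<And>m::nat. 0 < poly P (real m)"
    and P: "\<And>n k U V. finite U \<Longrightarrow> U \<subseteq> word_ball G S n \<Longrightarrow> finite V \<Longrightarrow> V \<subseteq> word_ball G S k \<Longrightarrow>
      real (card U) * real (card V) / poly P (real (n + k)) \<le> real (card (U <#> V))"
    using growth unfolding large_product_growth_def by blast
  obtain F where F: "A \<subseteq> carrier G" "finite F" "F \<subseteq> carrier G" "A <#> A \<subseteq> A <#> F"
    using A unfolding approximate_semigroup_def by blast
  have "F \<noteq> {}"
    using F(4) \<open>A \<noteq> {}\<close> by (auto simp: set_mult_def)
  then have Fpos: "0 < card F" using F(2) by (simp add: card_gt_0_iff)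
  obtain c where c: "m_inv G ` F \<subseteq> word_ball G S c"
    using finite_subset_word_ball[of "m_inv G ` F" G S] F by auto
  show thesis
  proof
    show "0 < poly (Polynomial.smult (real (card F)) P) (real m)" for m :: nat
      using Ppos Fpos by simp
    show "real (card (A \<inter> word_ball G S n)) * real (card (A \<inter> word_ball G S k))
        \<le> poly (Polynomial.smult (real (card F)) P) (real (n + k)) * real (card (A \<inter> word_ball G S (n + k + c)))"
      for n k
    proof -
      let ?U = "A \<inter> word_ball G S n" and ?V = "A \<inter> word_ball G S k"
      have "real (card ?U) * real (card ?V) / poly P (real (n + k)) \<le> real (card (?U <#> ?V))"
        using word_ball_finite_card_le(1)[OF fg] by (intro P) auto
      also have "\<dots> \<le> real (card (A \<inter> word_ball G S (n + k + c)) * card F)"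
        using approximate_semigroup_card_product_le[OF fg F(1-4) c] by (rule of_nat_mono)
      finally show ?thesis
        using Ppos[of "n + k"] by (simp add: divide_le_eq mult_ac)
    qed
  qed
qed

theorem theorem1p3:
  fixes G :: "('a, 'b) monoid_scheme" and S A :: "'a set"
  assumes "group G"
    and "finite_generating_set G S"
    and "large_product_growth G S"
    and "A \<noteq> {}"
    and "approximate_semigroup G A"
  shows "\<exists>\<omega> :: real.
    (\<lambda>n :: nat. 1 / real n * ln (real (card (A \<inter> word_ball G S n)))) \<longlonglongrightarrow> \<omega>"
proof -
  interpret group G by fact
  note fg = \<open>finite_generating_set G S\<close>
  define a where "a n = card (A \<inter> word_ball G S n)" for n
  have fin: "finite (A \<inter> word_ball G S n)" for n
    using word_ball_finite_card_le(1)[OF fg] by simp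
  obtain Q :: "real poly" and c where Qpos: "\<And>m::nat. 0 < poly Q (real m)"
    and Q: "\<And>n k. real (a n) * real (a k) \<le> poly Q (real (n + k)) * real (a (n + k + c))"
    using approximate_semigroup_ball_supermultiplicative[OF assms(2-5)] unfolding a_def by metis
  obtain K where K: "0 \<le> K" "\<And>n::nat. 1 \<le> n \<Longrightarrow> ln (poly Q (real n)) \<le> K * sqrt (real n)"
    using ln_poly_le_sqrt[of Q] Qpos by blast
  \<comment> \<open>Small balls may miss \<open>A\<close>, and there \<open>ln 0 = 0\<close> is meaningless; \<open>N\<close> is a radius past which they do not.\<close>
  obtain x where x: "x \<in> A" using \<open>A \<noteq> {}\<close> by blast
  define N where "N = Suc (word_dist G S \<one>\<^bsub>G\<^esub> x)"
  have apos: "1 \<le> a n" if "N \<le> n" for n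
  proof -
    have "x \<in> A \<inter> word_ball G S n"
      using x that assms(5) by (auto simp: N_def word_ball_def approximate_semigroup_def)
    then have "0 < a n" unfolding a_def card_gt_0_iff using fin by blast
    then show ?thesis by simp
  qed
  have "convergent (\<lambda>n. ln (real (a n)) / real n)"
  proof (rule nearly_superadditive_shift_convergent[where N = N and c = c and K = K
        and C = "ln (real (Suc (card (S \<union> m_inv G ` S))))"])
    fix n k assume nk: "N \<le> n" "N \<le> k"
    have pos: "0 < real (a n)" "0 < real (a k)" "0 < real (a (n + k + c))"
      using apos[of n] apos[of k] apos[of "n + k + c"] nk by auto
    have "ln (real (a n)) + ln (real (a k)) = ln (real (a n) * real (a k))"
      using pos by (simp add: ln_mult)
    also have "\<dots> \<le> ln (poly Q (real (n + k)) * real (a (n + k + c)))"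
      using Q[of n k] pos by (intro ln_mono) auto
    also have "\<dots> = ln (poly Q (real (n + k))) + ln (real (a (n + k + c)))"
      using Qpos[of "n + k"] pos by (simp add: ln_mult)
    also have "ln (poly Q (real (n + k))) \<le> K * sqrt (real (n + k))"
      using nk by (intro K(2)) (simp add: N_def)
    finally show "ln (real (a n)) + ln (real (a k))
        \<le> ln (real (a (n + k + c))) + K * sqrt (real (n + k))" by simp
  next
    fix n assume n: "N \<le> n"
    show "0 \<le> ln (real (a n))" using apos[OF n] by simp
    have "a n \<le> card (word_ball G S n)"
      unfolding a_def using word_ball_finite_card_le(1)[OF fg] by (intro card_mono) auto
    also have "\<dots> \<le> Suc (card (S \<union> m_inv G ` S)) ^ n"
      by (rule word_ball_finite_card_le(2)[OF fg])
    finally have "real (a n) \<le> real (Suc (card (S \<union> m_inv G ` S))) ^ n"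
      by (metis of_nat_mono of_nat_power)
    then have "ln (real (a n)) \<le> ln (real (Suc (card (S \<union> m_inv G ` S))) ^ n)"
      using apos[OF n] by (intro ln_mono) auto
    then show "ln (real (a n)) \<le> ln (real (Suc (card (S \<union> m_inv G ` S)))) * real n"
      by (subst (asm) ln_realpow) (auto simp: mult.commute)
  qed (use K in \<open>auto simp: N_def\<close>)
  then show ?thesis
    unfolding convergent_def a_def by (simp add: mult.commute divide_inverse)
qed

end
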